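(* Let $\succcurlyeq$ be a non-trivial binary relation on a real vector space $X$. The following are equivalent: (a) $\succcurlyeq$ is non-trivial, semi-transitive, additive, upper mixture-continuous and upper Archimedean. (b) $\succcurlyeq$ is representable by a mixture-linear function.
   Context: $x\succ y$ iff $x\succcurlyeq y$ and not $y\succcurlyeq x$; $x\sim y$ iff $x\succcurlyeq y$ and $y\succcurlyeq x$. For $\lambda\in[0,1]$, $x\lambda y=\lambda x+(1-\lambda)y$. Non-trivial: there exist $x,y\in X$ with $x\succ y$. Semi-transitive: for all $x,y,z\in X$, $x\succ y\sim z$ implies $x\succ z$, and $x\sim y\succ z$ implies $x\succ z$. Additive: for all $x,y,z\in X$, $x\succcurlyeq y$ if and only if $x+z\succcurlyeq y+z$. Upper mixture-continuous: for all $x,y,z\in X$ the set $\{\lambda\in[0,1]:x\lambda y\succcurlyeq z\}$ is closed. Upper Archimedean: for all $x,y,z\in X$ with $x\succ y$ there exists $\lambda\in(0,1)$ with $x\lambda z\succ y$. A function $l:X\to\mathbb{R}$ is mixture-linear if $l(x\lambda y)=\lambda l(x)+(1-\lambda)l(y)$ for all $x,y\in X$, $\lambda\in[0,1]$. $\succcurlyeq$ is representable by $l$ if for all $x,y\in X$: $x\succcurlyeq y$ if and only if $l(x)\ge l(y)$. *)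

theory Defs
  imports Complex_Main
begin

definition strict_part :: "('a \<Rightarrow> 'a \<Rightarrow> bool) \<Rightarrow> 'a \<Rightarrow> 'a \<Rightarrow> bool" where
  "strict_part R x y \<longleftrightarrow> R x y \<and> \<not> R y x"

definition indiff_part :: "('a \<Rightarrow> 'a \<Rightarrow> bool) \<Rightarrow> 'a \<Rightarrow> 'a \<Rightarrow> bool" where
  "indiff_part R x y \<longleftrightarrow> R x y \<and> R y x"

text \<open>The weight is attached to the first point: \<open>mixture x \<alpha> y\<close> is \<open>x\<close> at \<open>\<alpha> = 1\<close>
  and \<open>y\<close> at \<open>\<alpha> = 0\<close>.\<close>

definition mixture :: "'a::real_vector \<Rightarrow> real \<Rightarrow> 'a \<Rightarrow> 'a" where
  "mixture x \<alpha> y = \<alpha> *\<^sub>R x + (1 - \<alpha>) *\<^sub>R y"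

definition nontrivial_rel :: "('a \<Rightarrow> 'a \<Rightarrow> bool) \<Rightarrow> bool" where
  "nontrivial_rel R \<longleftrightarrow> (\<exists>x y. strict_part R x y)"

definition semi_transitive_rel :: "('a \<Rightarrow> 'a \<Rightarrow> bool) \<Rightarrow> bool" where
  "semi_transitive_rel R \<longleftrightarrow>
     (\<forall>x y z. (strict_part R x y \<and> indiff_part R y z \<longrightarrow> strict_part R x z) \<and>
              (indiff_part R x y \<and> strict_part R y z \<longrightarrow> strict_part R x z))"

definition additive_rel :: "('a::real_vector \<Rightarrow> 'a \<Rightarrow> bool) \<Rightarrow> bool" where
  "additive_rel R \<longleftrightarrow> (\<forall>x y z. R x y \<longleftrightarrow> R (x + z) (y + z))"

definition upper_mixture_continuous :: "('a::real_vector \<Rightarrow> 'a \<Rightarrow> bool) \<Rightarrow> bool" where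
  "upper_mixture_continuous R \<longleftrightarrow>
     (\<forall>x y z. closed {\<alpha>::real. \<alpha> \<in> {0..1} \<and> R (mixture x \<alpha> y) z})"

definition upper_Archimedean :: "('a::real_vector \<Rightarrow> 'a \<Rightarrow> bool) \<Rightarrow> bool" where
  "upper_Archimedean R \<longleftrightarrow>
     (\<forall>x y z. strict_part R x y \<longrightarrow> (\<exists>\<alpha>\<in>{0<..<1}. strict_part R (mixture x \<alpha> z) y))"

definition mixture_linear :: "('a::real_vector \<Rightarrow> real) \<Rightarrow> bool" where
  "mixture_linear l \<longleftrightarrow>
     (\<forall>x y. \<forall>\<alpha>\<in>{0..1}. l (mixture x \<alpha> y) = \<alpha> * l x + (1 - \<alpha>) * l y)"

definition representable_by :: "('a \<Rightarrow> 'a \<Rightarrow> bool) \<Rightarrow> ('a \<Rightarrow> real) \<Rightarrow> bool" where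
  "representable_by R l \<longleftrightarrow> (\<forall>x y. R x y \<longleftrightarrow> l x \<ge> l y)"

end

theory Submission
  imports Defs
begin

text \<open>
  By additivity the relation is determined by the set \<open>C\<close> of points weakly above \<open>0\<close>, which
  splits into a strict part \<open>P\<close> and an indifference part \<open>I\<close>. On a segment running from \<open>C\<close> to a
  point outside \<open>C\<close>, closedness gives a last point in \<open>C\<close>, and the Archimedean property
  forces this point into \<open>I\<close>. Since translation by \<open>I\<close> preserves \<open>P\<close>, such gaps in \<open>C\<close> repeat
  periodically, which gives \<open>0 \<in> C\<close> and makes \<open>I\<close> a subgroup and then a subspace. A segment from
  \<open>p \<in> P\<close> to \<open>z \<notin> C\<close> crosses \<open>I\<close>, so \<open>I\<close> is a hyperplane complementary to the line through \<open>p\<close>,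
  and the coordinate along \<open>p\<close> is the representing function.
\<close>

section \<open>Segments, periods and the upper set \<open>C\<close>\<close>

lemma mixture_eq: "mixture x \<alpha> y = y + \<alpha> *\<^sub>R (x - y)"
  by (simp add: mixture_def algebra_simps)

text \<open>Serves to carry a point of a line into a given gap by translations through multiples of
  the period \<open>d\<close>.\<close>

lemma exists_int_shift_into_interval:
  fixes t u d :: real
  assumes "d > 0"
  obtains k :: int where "u \<le> t - of_int k * d" "t - of_int k * d < u + d"
proof -
  define k where "k = \<lfloor>(t - u) / d\<rfloor>"
  have "of_int k \<le> (t - u) / d" "(t - u) / d < of_int k + 1"
    unfolding k_def by linarith+
  then show ?thesis
    using assms by (intro that[of k]) (simp_all add: field_simps)
qed

text \<open>With \<open>C\<close> the set of \<open>v\<close> such that \<open>R v 0\<close>, the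
  assumptions are the axioms read at the point 0. Reflexivity and completeness have to be derived: a
  priori \<open>0\<close>, or both a vector and its negative, may lie outside
  \<open>C\<close>.\<close>

locale archimedean_upper_set =
  fixes C P I :: "'a::real_vector set"
  defines "P \<equiv> {x. x \<in> C \<and> - x \<notin> C}" and "I \<equiv> {x. x \<in> C \<and> - x \<in> C}"
  assumes P_add_I: "\<And>x y. x \<in> P \<Longrightarrow> y \<in> I \<Longrightarrow> x + y \<in> P"
    and closed_segment_part: "\<And>x y. closed {\<alpha>. \<alpha> \<in> {0..1} \<and> mixture x \<alpha> y \<in> C}"
    and archimedean: "\<And>x z. x \<in> P \<Longrightarrow> \<exists>\<alpha>\<in>{0<..<1}. mixture x \<alpha> z \<in> P"
    and P_nonempty: "P \<noteq> {}"
begin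

lemma I_uminus: "x \<in> I \<Longrightarrow> - x \<in> I"
  by (simp add: I_def)

lemma C_eq: "C = P \<union> I"
  by (auto simp: P_def I_def)

lemma P_I_disjoint: "x \<in> P \<Longrightarrow> x \<notin> I"
  by (simp add: P_def I_def)

lemma P_diff_I: "x \<in> P \<Longrightarrow> y \<in> I \<Longrightarrow> x - y \<in> P"
  using P_add_I[OF _ I_uminus] by simp

lemma segment_exit:
  assumes "x \<in> C" "y \<notin> C"
  obtains \<alpha> where "0 < \<alpha>" "\<alpha> \<le> 1" "y + \<alpha> *\<^sub>R (x - y) \<in> I"
    "\<And>\<beta>. 0 \<le> \<beta> \<Longrightarrow> \<beta> < \<alpha> \<Longrightarrow> y + \<beta> *\<^sub>R (x - y) \<notin> C"
proof -
  define S where "S = {\<alpha>. \<alpha> \<in> {0..1} \<and> mixture x \<alpha> y \<in> C}"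
  have "1 \<in> S"
    using assms by (simp add: S_def mixture_eq)
  have "compact ({0..1} \<inter> S)"
    using closed_segment_part by (intro compact_Int_closed compact_Icc) (simp add: S_def)
  also have "{0..1} \<inter> S = S"
    by (auto simp: S_def)
  finally obtain \<alpha> where "\<alpha> \<in> S" and least: "\<And>\<beta>. \<beta> \<in> S \<Longrightarrow> \<alpha> \<le> \<beta>"
    using compact_attains_inf[of S] \<open>1 \<in> S\<close> by blast
  then have \<alpha>: "0 \<le> \<alpha>" "\<alpha> \<le> 1" "mixture x \<alpha> y \<in> C"
    by (auto simp: S_def)
  have "\<alpha> \<noteq> 0"
    using \<alpha> assms by (auto simp: mixture_eq)
  then have "\<alpha> > 0"
    using \<alpha> by simp
  \<comment> \<open>Mixing a strict exit point further with \<open>y\<close> would give a point of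
    \<open>C\<close> at the weight \<open>\<beta> * \<alpha>\<close>, below the least one.\<close>
  have "mixture x \<alpha> y \<notin> P"
  proof
    assume "mixture x \<alpha> y \<in> P"
    then obtain \<beta> where \<beta>: "\<beta> \<in> {0<..<1}" "mixture (mixture x \<alpha> y) \<beta> y \<in> P"
      using archimedean by blast
    have "mixture (mixture x \<alpha> y) \<beta> y = mixture x (\<beta> * \<alpha>) y"
      by (simp add: mixture_eq)
    then have "\<beta> * \<alpha> \<in> S"
      using \<beta> \<alpha> C_eq by (auto simp: S_def intro: mult_le_one)
    then show False
      using least \<beta> \<open>\<alpha> > 0\<close> by fastforce
  qed
  then have "mixture x \<alpha> y \<in> I"
    using \<alpha> C_eq by blast
  moreover have "y + \<beta> *\<^sub>R (x - y) \<notin> C" if "0 \<le> \<beta>" "\<beta> < \<alpha>" for \<beta>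
    using least[of \<beta>] that \<alpha> by (auto simp: S_def mixture_eq)
  ultimately show ?thesis
    using that \<alpha> \<open>\<alpha> > 0\<close> by (simp add: mixture_eq)
qed

text \<open>If \<open>g \<notin> C\<close>, the segment from \<open>g\<close> to
  \<open>p + g\<close> first meets \<open>C\<close> at a point g + \<alpha> p of \<open>I\<close>.
  Subtracting this point and adding \<open>g\<close> keeps vectors in \<open>P\<close>, so
  \<open>P\<close> contains p - k \<alpha> p for every natural k. Choosing k with coefficient in [0,
  \<alpha>) and adding \<open>g\<close> lands in the gap, yet in \<open>P\<close>.\<close>

lemma translation_preserving_P_in_C:
  assumes shift: "\<And>v. v \<in> P \<Longrightarrow> v + g \<in> P"
  shows "g \<in> C"
proof (rule ccontr)
  assume "g \<notin> C"
  obtain p where p: "p \<in> P"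
    using P_nonempty by blast
  have "p + g \<in> C"
    using shift[OF p] C_eq by blast
  then obtain \<alpha> where \<alpha>: "0 < \<alpha>" "\<alpha> \<le> 1" "g + \<alpha> *\<^sub>R p \<in> I"
    and gap: "\<And>\<beta>. 0 \<le> \<beta> \<Longrightarrow> \<beta> < \<alpha> \<Longrightarrow> g + \<beta> *\<^sub>R p \<notin> C"
    using segment_exit[OF _ \<open>g \<notin> C\<close>, of "p + g"] by (auto simp: algebra_simps)
  have multiples: "(1 - real k * \<alpha>) *\<^sub>R p \<in> P" for k
  proof (induction k)
    case (Suc k)
    have "(1 - real k * \<alpha>) *\<^sub>R p - (g + \<alpha> *\<^sub>R p) + g \<in> P"
      by (intro shift P_diff_I Suc \<alpha>)
    then show ?case
      by (simp add: algebra_simps)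
  qed (simp add: p)
  obtain k :: int where k: "0 \<le> 1 - of_int k * \<alpha>" "1 - of_int k * \<alpha> < 0 + \<alpha>"
    using exists_int_shift_into_interval[OF \<alpha>(1)] by blast
  \<comment> \<open>\<open>multiples\<close> covers natural indices only; a negative
    \<open>k\<close> would make the coefficient at least 1, hence not below \<alpha>.\<close>
  have "k \<ge> 0"
  proof (rule ccontr)
    assume "\<not> k \<ge> 0"
    then have "of_int k * \<alpha> \<le> 0"
      using \<alpha> by (simp add: mult_nonpos_nonneg)
    then show False
      using k \<alpha> \<open>\<not> k \<ge> 0\<close> by linarith
  qed
  then have "(1 - of_int k * \<alpha>) *\<^sub>R p + g \<in> P"
    using shift[OF multiples[of "nat k"]] by simp
  then show False
    using gap[of "1 - of_int k * \<alpha>"] k C_eq by (simp add: add.commute)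
qed

section \<open>\<open>I\<close> is a linear subspace\<close>

lemma zero_in_I: "0 \<in> I"
  using translation_preserving_P_in_C[of 0] by (simp add: I_def)

text \<open>Translations by two elements of \<open>I\<close> compose to one that preserves
  \<open>P\<close>, so the sum is in \<open>C\<close>; the same argument for the negatives gives the
  other half.\<close>

lemma I_add:
  assumes "x \<in> I" "y \<in> I"
  shows "x + y \<in> I"
proof -
  have "u + v \<in> C" if "u \<in> I" "v \<in> I" for u v
    by (rule translation_preserving_P_in_C) (metis P_add_I that add.assoc)
  from this[OF assms] this[OF assms[THEN I_uminus]] show ?thesis
    by (simp add: I_def)
qed

lemma I_scaleR_int:
  assumes "x \<in> I"
  shows "of_int k *\<^sub>R x \<in> I"
proof -
  have *: "real n *\<^sub>R x \<in> I" for n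
    by (induction n) (use assms zero_in_I I_add in \<open>auto simp: algebra_simps\<close>)
  show ?thesis
    using *[of "nat k"] I_uminus[OF *[of "nat (- k)"]] by (cases "k \<ge> 0") auto
qed

text \<open>The gap of \<open>C\<close> around \<open>- (t *\<^sub>R x)\<close> has endpoints in \<open>I\<close>, so its translates by multiples of
  its length cover the line up to points of \<open>I\<close>.\<close>

lemma scaleR_I_notin_P:
  assumes x: "x \<in> I"
  shows "t *\<^sub>R x \<notin> P"
proof
  assume t: "t *\<^sub>R x \<in> P"
  then have "(- t) *\<^sub>R x \<notin> C"
    by (simp add: P_def)
  obtain m :: int where m: "\<bar>t\<bar> < of_int m"
    using ex_less_of_int by blast
  \<comment> \<open>Integer multiples of \<open>x\<close> are already in \<open>I\<close>, and
    \<open>m\<close> exceeds the absolute value of \<open>t\<close>, so these two points of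
    \<open>C\<close> enclose the coefficient \<open>- t\<close>.\<close>
  have ends: "of_int m *\<^sub>R x \<in> C" "(- of_int m) *\<^sub>R x \<in> C"
    using I_scaleR_int[OF x, of m] I_uminus C_eq by auto
  obtain v where v: "- t < v" "v *\<^sub>R x \<in> I" "\<And>r. - t \<le> r \<Longrightarrow> r < v \<Longrightarrow> r *\<^sub>R x \<notin> C"
  proof -
    obtain \<alpha> where \<alpha>: "0 < \<alpha>" "(- t) *\<^sub>R x + \<alpha> *\<^sub>R (of_int m *\<^sub>R x - (- t) *\<^sub>R x) \<in> I"
      "\<And>\<beta>. 0 \<le> \<beta> \<Longrightarrow> \<beta> < \<alpha> \<Longrightarrow> (- t) *\<^sub>R x + \<beta> *\<^sub>R (of_int m *\<^sub>R x - (- t) *\<^sub>R x) \<notin> C"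
      using segment_exit[OF ends(1) \<open>(- t) *\<^sub>R x \<notin> C\<close>] by metis
    \<comment> \<open>Converts the weight on the segment into the coefficient of \<open>x\<close>,
      so that the gap becomes an interval of reals.\<close>
    have eq: "(- t) *\<^sub>R x + \<beta> *\<^sub>R (of_int m *\<^sub>R x - (- t) *\<^sub>R x) = (- t + \<beta> * (of_int m + t)) *\<^sub>R x" for \<beta>
      by (simp add: algebra_simps)
    have pos: "of_int m + t > 0"
      using m by linarith
    show ?thesis
    proof (rule that[of "- t + \<alpha> * (of_int m + t)"])
      fix r assume r: "- t \<le> r" "r < - t + \<alpha> * (of_int m + t)"
      have "r = - t + (r + t) / (of_int m + t) * (of_int m + t)"
        using pos by simp
      moreover have "0 \<le> (r + t) / (of_int m + t)" "(r + t) / (of_int m + t) < \<alpha>"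
        using r pos by (auto simp: divide_less_eq)
      ultimately show "r *\<^sub>R x \<notin> C"
        using \<alpha>(3)[unfolded eq] by metis
    qed (use \<alpha>(1,2)[unfolded eq] pos in auto)
  qed
  obtain u where u: "u < - t" "u *\<^sub>R x \<in> I" "\<And>r. u < r \<Longrightarrow> r \<le> - t \<Longrightarrow> r *\<^sub>R x \<notin> C"
  proof -
    obtain \<alpha> where \<alpha>: "0 < \<alpha>" "(- t) *\<^sub>R x + \<alpha> *\<^sub>R ((- of_int m) *\<^sub>R x - (- t) *\<^sub>R x) \<in> I"
      "\<And>\<beta>. 0 \<le> \<beta> \<Longrightarrow> \<beta> < \<alpha> \<Longrightarrow> (- t) *\<^sub>R x + \<beta> *\<^sub>R ((- of_int m) *\<^sub>R x - (- t) *\<^sub>R x) \<notin> C"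
      using segment_exit[OF ends(2) \<open>(- t) *\<^sub>R x \<notin> C\<close>] by metis
    have eq: "(- t) *\<^sub>R x + \<beta> *\<^sub>R ((- of_int m) *\<^sub>R x - (- t) *\<^sub>R x) = (- t - \<beta> * (of_int m - t)) *\<^sub>R x" for \<beta>
      by (simp add: algebra_simps)
    have pos: "of_int m - t > 0"
      using m by linarith
    show ?thesis
    proof (rule that[of "- t - \<alpha> * (of_int m - t)"])
      fix r assume r: "- t - \<alpha> * (of_int m - t) < r" "r \<le> - t"
      have "r = - t - (- t - r) / (of_int m - t) * (of_int m - t)"
        using pos by simp
      moreover have "0 \<le> (- t - r) / (of_int m - t)" "(- t - r) / (of_int m - t) < \<alpha>"
        using r pos by (auto simp: divide_less_eq)
      ultimately show "r *\<^sub>R x \<notin> C"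
        using \<alpha>(3)[unfolded eq] by metis
    qed (use \<alpha>(1,2)[unfolded eq] pos in auto)
  qed
  have "(v - u) *\<^sub>R x \<in> I"
    using I_add[OF v(2) I_uminus[OF u(2)]] by (simp add: algebra_simps)
  obtain k :: int where k: "u \<le> t - of_int k * (v - u)" "t - of_int k * (v - u) < u + (v - u)"
    using exists_int_shift_into_interval[of "v - u" u t] u v by auto
  have "t *\<^sub>R x - of_int k *\<^sub>R (v - u) *\<^sub>R x \<in> P"
    using P_diff_I[OF t I_scaleR_int[OF \<open>(v - u) *\<^sub>R x \<in> I\<close>]] .
  then have in_P: "(t - of_int k * (v - u)) *\<^sub>R x \<in> P"
    by (simp add: algebra_simps)
  \<comment> \<open>The shift only reaches the half-open interval from \<open>u\<close> to
    \<open>v\<close>; its left end gives a point of \<open>I\<close>, and all other coefficients lie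
    in the gap.\<close>
  then have "t - of_int k * (v - u) \<noteq> u"
    using P_I_disjoint u(2) by metis
  then have "(t - of_int k * (v - u)) *\<^sub>R x \<notin> C"
    using u(3) v(3) k by (cases "t - of_int k * (v - u) \<le> - t") auto
  then show False
    using in_P C_eq by blast
qed

text \<open>The line through \<open>p\<close> in direction \<open>x\<close> misses \<open>I\<close>,
  since a common point would put a multiple of \<open>x\<close> into \<open>P\<close>. A segment on
  it that left \<open>C\<close> would cross \<open>I\<close>, so the line stays in
  \<open>P\<close>.\<close>

lemma P_add_scaleR_I:
  assumes p: "p \<in> P" and x: "x \<in> I"
  shows "p + t *\<^sub>R x \<in> P"
proof -
  have no_I: "p + r *\<^sub>R x \<notin> I" for r
  proof
    assume "p + r *\<^sub>R x \<in> I"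
    then have "(- r) *\<^sub>R x \<in> P"
      using P_diff_I[OF p] by fastforce
    then show False
      using scaleR_I_notin_P[OF x] by blast
  qed
  have "p + t *\<^sub>R x \<in> C"
  proof (rule ccontr)
    assume "p + t *\<^sub>R x \<notin> C"
    then obtain \<alpha> where "p + t *\<^sub>R x + \<alpha> *\<^sub>R (p - (p + t *\<^sub>R x)) \<in> I"
      using segment_exit[of p] p C_eq by blast
    then show False
      using no_I[of "t - \<alpha> * t"] by (simp add: algebra_simps)
  qed
  then show ?thesis
    using no_I C_eq by blast
qed

lemma I_scaleR:
  assumes "x \<in> I"
  shows "t *\<^sub>R x \<in> I"
proof -
  have "r *\<^sub>R x \<in> C" for r
    by (rule translation_preserving_P_in_C) (rule P_add_scaleR_I[OF _ assms])
  from this[of t] this[of "- t"] show ?thesis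
    by (simp add: I_def)
qed

lemma subspace_I: "subspace I"
  using zero_in_I I_add I_scaleR by (simp add: subspace_def)

section \<open>The coordinate along a vector of \<open>P\<close>\<close>

lemma notin_C_crosses_I:
  assumes p: "p \<in> P" and z: "z \<notin> C"
  obtains c where "c > 0" "z + c *\<^sub>R p \<in> I"
proof -
  obtain \<alpha> where \<alpha>: "0 < \<alpha>" "\<alpha> \<le> 1" "z + \<alpha> *\<^sub>R (p - z) \<in> I"
    using segment_exit[OF _ z, of p] p C_eq by blast
  have "\<alpha> \<noteq> 1"
    using \<alpha> P_I_disjoint[OF p] by auto
  then have "\<alpha> < 1"
    using \<alpha> by simp
  \<comment> \<open>The crossing point is (1 - \<alpha>) z + \<alpha> p; rescaling it within
    \<open>I\<close> to make the coefficient of \<open>z\<close> equal to 1 yields c = \<alpha> / (1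
    - \<alpha>).\<close>
  have "(1 / (1 - \<alpha>)) *\<^sub>R (z + \<alpha> *\<^sub>R (p - z)) \<in> I"
    using \<alpha> I_scaleR by blast
  also have "z + \<alpha> *\<^sub>R (p - z) = (1 - \<alpha>) *\<^sub>R z + \<alpha> *\<^sub>R p"
    by (simp add: algebra_simps)
  finally show ?thesis
    using that[of "\<alpha> / (1 - \<alpha>)"] \<alpha> \<open>\<alpha> < 1\<close> by (simp add: scaleR_add_right)
qed

lemma scaleR_P_notin_I:
  assumes "p \<in> P" "s \<noteq> 0"
  shows "s *\<^sub>R p \<notin> I"
  using I_scaleR[of "s *\<^sub>R p" "1 / s"] P_I_disjoint assms by auto

text \<open>Otherwise a crossing of \<open>I\<close> in direction \<open>p\<close> would put a
  positive multiple of \<open>p\<close> into \<open>I\<close>.\<close>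

lemma scaleR_P:
  assumes p: "p \<in> P" and "s > 0"
  shows "s *\<^sub>R p \<in> P"
proof -
  have "s *\<^sub>R p \<in> C"
  proof (rule ccontr)
    assume "s *\<^sub>R p \<notin> C"
    then obtain c where "c > 0" "s *\<^sub>R p + c *\<^sub>R p \<in> I"
      using notin_C_crosses_I[OF p] by metis
    then show False
      using scaleR_P_notin_I[OF p, of "s + c"] \<open>s > 0\<close> by (simp add: scaleR_add_left)
  qed
  then show ?thesis
    using scaleR_P_notin_I[OF p, of s] \<open>s > 0\<close> C_eq by auto
qed

text \<open>Outside \<open>I\<close>, one of \<open>z\<close> and \<open>- z\<close> is not in
  \<open>C\<close>, and moving from it in direction \<open>p\<close> reaches
  \<open>I\<close>.\<close>

lemma coordinate_exists:
  assumes p: "p \<in> P"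
  shows "\<exists>s. z - s *\<^sub>R p \<in> I"
proof -
  consider "z \<in> I" | "z \<notin> C" | "- z \<notin> C"
    by (auto simp: I_def)
  then show ?thesis
  proof cases
    case 1
    then show ?thesis
      by (intro exI[of _ 0]) simp
  next
    case 2
    then obtain c where "z + c *\<^sub>R p \<in> I"
      using notin_C_crosses_I[OF p] by metis
    then show ?thesis
      by (intro exI[of _ "- c"]) simp
  next
    case 3
    then obtain c where "- z + c *\<^sub>R p \<in> I"
      using notin_C_crosses_I[OF p] by metis
    from I_uminus[OF this] show ?thesis
      by (intro exI[of _ c]) simp
  qed
qed

lemma coordinate_unique:
  assumes p: "p \<in> P" and "z - s *\<^sub>R p \<in> I" "z - t *\<^sub>R p \<in> I"
  shows "s = t"
proof (rule ccontr)
  assume "s \<noteq> t"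
  have "(t - s) *\<^sub>R p \<in> I"
    using subspace_diff[OF subspace_I assms(2,3)] by (simp add: algebra_simps)
  then show False
    using scaleR_P_notin_I[OF p, of "t - s"] \<open>s \<noteq> t\<close> by simp
qed

text \<open>\<open>C\<close> is a closed half-space bounded by \<open>I\<close>: as \<open>P\<close>
  absorbs \<open>I\<close>, the sign of \<open>s\<close> decides whether \<open>z\<close> or
  \<open>- z\<close> is in \<open>P\<close>.\<close>

lemma in_C_iff_coordinate:
  assumes p: "p \<in> P" and z: "z - s *\<^sub>R p \<in> I"
  shows "z \<in> C \<longleftrightarrow> 0 \<le> s"
proof -
  consider "s = 0" | "s > 0" | "s < 0"
    by linarith
  then show ?thesis
  proof cases
    case 1
    then show ?thesis
      using z C_eq by auto
  next
    case 2
    then have "s *\<^sub>R p + (z - s *\<^sub>R p) \<in> P"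
      using P_add_I scaleR_P p z by blast
    then show ?thesis
      using 2 C_eq by auto
  next
    case 3
    then have "(- s) *\<^sub>R p + - (z - s *\<^sub>R p) \<in> P"
      using P_add_I scaleR_P[OF p, of "- s"] I_uminus[OF z] 3 neg_0_less_iff_less by blast
    then have "- z \<in> P"
      by simp
    then show ?thesis
      using 3 by (simp add: P_def)
  qed
qed

lemma exists_linear_functional: "\<exists>l. linear l \<and> (\<forall>z. z \<in> C \<longleftrightarrow> 0 \<le> (l z :: real))"
proof -
  obtain p where p: "p \<in> P"
    using P_nonempty by blast
  \<comment> \<open>Coordinates are chosen pointwise; their uniqueness makes the choice
    linear.\<close>
  obtain l where l: "\<And>z. z - l z *\<^sub>R p \<in> I"
    using coordinate_exists[OF p] by metis
  have "linear l"
  proof (rule linearI)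
    fix x y :: 'a and r :: real
    have "(x - l x *\<^sub>R p) + (y - l y *\<^sub>R p) \<in> I"
      using I_add l by blast
    then have "x + y - (l x + l y) *\<^sub>R p \<in> I"
      by (simp add: algebra_simps)
    then show "l (x + y) = l x + l y"
      by (rule coordinate_unique[OF p l])
    have "r *\<^sub>R (x - l x *\<^sub>R p) \<in> I"
      using I_scaleR l by blast
    then have "r *\<^sub>R x - (r *\<^sub>R l x) *\<^sub>R p \<in> I"
      by (simp add: algebra_simps)
    then show "l (r *\<^sub>R x) = r *\<^sub>R l x"
      by (rule coordinate_unique[OF p l])
  qed
  then show ?thesis
    using in_C_iff_coordinate[OF p l] by blast
qed

end

section \<open>The axioms yield a representation\<close>

lemma additive_rel_diff:
  assumes "additive_rel R"
  shows "R x y \<longleftrightarrow> R (x - y) 0"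
proof -
  have "R x y \<longleftrightarrow> R (x + - y) (y + - y)"
    using assms unfolding additive_rel_def by blast
  then show ?thesis
    by simp
qed

lemma additive_rel_representable:
  fixes R :: "'a::real_vector \<Rightarrow> 'a \<Rightarrow> bool"
  assumes nontriv: "nontrivial_rel R" and semi: "semi_transitive_rel R"
    and add: "additive_rel R" and umc: "upper_mixture_continuous R"
    and arch: "upper_Archimedean R"
  shows "\<exists>l. mixture_linear l \<and> representable_by R l"
proof -
  define C where "C = {v. R v 0}"
  have R_iff: "R x y \<longleftrightarrow> x - y \<in> C" for x y
    using additive_rel_diff[OF add] by (simp add: C_def)
  have strict: "strict_part R x y \<longleftrightarrow> x - y \<in> {v. v \<in> C \<and> - v \<notin> C}" for x y
    by (simp add: strict_part_def R_iff)
  have indiff: "indiff_part R x y \<longleftrightarrow> x - y \<in> {v. v \<in> C \<and> - v \<in> C}" for x y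
    by (simp add: indiff_part_def R_iff)
  interpret archimedean_upper_set C "{x. x \<in> C \<and> - x \<notin> C}" "{x. x \<in> C \<and> - x \<in> C}"
  proof unfold_locales
    fix x y
    assume "x \<in> {x. x \<in> C \<and> - x \<notin> C}" "y \<in> {x. x \<in> C \<and> - x \<in> C}"
    \<comment> \<open>Semi-transitivity is applied to \<open>x\<close> strictly above
      \<open>0\<close> and \<open>0\<close> indifferent to \<open>- y\<close>.\<close>
    then have "strict_part R x 0" "indiff_part R 0 (- y)"
      by (simp_all add: strict indiff)
    then have "strict_part R x (- y)"
      using semi unfolding semi_transitive_rel_def by blast
    then show "x + y \<in> {x. x \<in> C \<and> - x \<notin> C}"
      by (simp add: strict)
  next
    fix x y
    show "closed {\<alpha>. \<alpha> \<in> {0..1} \<and> mixture x \<alpha> y \<in> C}"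
      using umc unfolding upper_mixture_continuous_def C_def by simp
  next
    fix x z
    assume "x \<in> {x. x \<in> C \<and> - x \<notin> C}"
    then have "strict_part R x 0"
      by (simp add: strict)
    then obtain \<alpha> where "\<alpha> \<in> {0<..<1}" "strict_part R (mixture x \<alpha> z) 0"
      using arch unfolding upper_Archimedean_def by blast
    then show "\<exists>\<alpha>\<in>{0<..<1}. mixture x \<alpha> z \<in> {x. x \<in> C \<and> - x \<notin> C}"
      by (auto simp: strict)
  next
    show "{x. x \<in> C \<and> - x \<notin> C} \<noteq> {}"
      using nontriv strict unfolding nontrivial_rel_def by blast
  qed
  obtain l :: "'a \<Rightarrow> real" where "linear l" and l: "\<And>z. z \<in> C \<longleftrightarrow> 0 \<le> l z"
    using exists_linear_functional by blast
  have "mixture_linear l"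
    using \<open>linear l\<close> by (simp add: mixture_linear_def mixture_def linear_add linear_scale)
  moreover have "representable_by R l"
    using \<open>linear l\<close> by (simp add: representable_by_def R_iff l linear_diff)
  ultimately show ?thesis
    by blast
qed

section \<open>Representable relations satisfy the axioms\<close>

lemma mixture_linear_add:
  assumes "mixture_linear l"
  shows "l (x + y) = l x + l y - l 0"
proof -
  have half: "l (mixture u (1/2) v) = l u / 2 + l v / 2" for u v
    using assms by (simp add: mixture_linear_def)
  \<comment> \<open>The two pairs share a midpoint. Since \<open>l\<close> is only affine,
    \<open>l 0\<close> remains as a correction.\<close>
  have "mixture (x + y) (1/2) 0 = mixture x (1/2) y"
    by (simp add: mixture_def scaleR_add_right)
  then show ?thesis
    using half[of "x + y" 0] half[of x y] by simp
qed

lemma strict_part_representable: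
  "representable_by R l \<Longrightarrow> strict_part R x y \<longleftrightarrow> l x > l y"
  by (auto simp: strict_part_def representable_by_def)

lemma indiff_part_representable:
  "representable_by R l \<Longrightarrow> indiff_part R x y \<longleftrightarrow> l x = l y"
  by (auto simp: indiff_part_def representable_by_def)

lemma representable_semi_transitive_rel: "representable_by R l \<Longrightarrow> semi_transitive_rel R"
  by (simp add: semi_transitive_rel_def strict_part_representable indiff_part_representable)

lemma representable_additive_rel:
  "mixture_linear l \<Longrightarrow> representable_by R l \<Longrightarrow> additive_rel R"
  by (simp add: additive_rel_def representable_by_def mixture_linear_add)

text \<open>Along a segment \<open>l\<close> is affine in the weight, so the set is a closed
  superlevel set within the unit interval.\<close>

lemma representable_upper_mixture_continuous:
  assumes "mixture_linear l" "representable_by R l"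
  shows "upper_mixture_continuous R"
  unfolding upper_mixture_continuous_def
proof (intro allI)
  fix x y z
  have "{\<alpha>. \<alpha> \<in> {0..1} \<and> R (mixture x \<alpha> y) z}
      = {0..1} \<inter> {\<alpha>. l z \<le> \<alpha> * l x + (1 - \<alpha>) * l y}"
    using assms by (auto simp: mixture_linear_def representable_by_def)
  also have "closed \<dots>"
    by (intro closed_Int closed_atLeastAtMost closed_Collect_le continuous_intros)
  finally show "closed {\<alpha>. \<alpha> \<in> {0..1} \<and> R (mixture x \<alpha> y) z}" .
qed

lemma representable_upper_Archimedean:
  assumes "mixture_linear l" "representable_by R l"
  shows "upper_Archimedean R"
  unfolding upper_Archimedean_def
proof (intro allI impI)
  fix x y z
  assume "strict_part R x y"
  then have "l y < l x"
    using strict_part_representable[OF assms(2)] by blast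
  \<comment> \<open>As the weight tends to 1 from below, the value at the mixture tends to
    \<open>l x\<close>, so weights near 1 keep it above \<open>l y\<close>.\<close>
  have "((\<lambda>\<alpha>. \<alpha> * l x + (1 - \<alpha>) * l z) \<longlongrightarrow> 1 * l x + (1 - 1) * l z) (at_left 1)"
    by (intro tendsto_intros)
  then have "\<forall>\<^sub>F \<alpha> in at_left 1. l y < \<alpha> * l x + (1 - \<alpha>) * l z"
    using order_tendstoD(1) \<open>l y < l x\<close> by fastforce
  moreover have "\<forall>\<^sub>F \<alpha> in at_left 1. \<alpha> \<in> {0<..<1::real}"
    by (rule eventually_at_leftI[of 0]) auto
  ultimately have "\<forall>\<^sub>F \<alpha> in at_left 1. \<alpha> \<in> {0<..<1} \<and> l y < \<alpha> * l x + (1 - \<alpha>) * l z"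
    by eventually_elim simp
  then obtain \<alpha> where \<alpha>: "\<alpha> \<in> {0<..<1}" "l y < \<alpha> * l x + (1 - \<alpha>) * l z"
    using eventually_happens'[OF trivial_limit_at_left_real] by blast
  then have "l y < l (mixture x \<alpha> z)"
    using assms(1) by (auto simp: mixture_linear_def)
  then show "\<exists>\<alpha>\<in>{0<..<1}. strict_part R (mixture x \<alpha> z) y"
    using \<alpha>(1) strict_part_representable[OF assms(2)] by blast
qed

theorem proposition5:
  fixes R :: "'a::real_vector \<Rightarrow> 'a \<Rightarrow> bool"
  assumes "nontrivial_rel R"
  shows "(nontrivial_rel R \<and> semi_transitive_rel R \<and> additive_rel R \<and>
            upper_mixture_continuous R \<and> upper_Archimedean R)
         \<longleftrightarrow> (\<exists>l. mixture_linear l \<and> representable_by R l)"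
  using assms additive_rel_representable representable_semi_transitive_rel
    representable_additive_rel representable_upper_mixture_continuous
    representable_upper_Archimedean
  by metis

end
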